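(* Let $(\alpha,p)\in\Pi_3$. Then there exists a function $F:\mathbb{T}\to\mathbb{C}$, absolutely continuous on $\mathbb{T}$ with $\dot F\in\mathcal{L}^p(\mathbb{T})$, such that the mapping $f=\mathcal{K}_\alpha[F]$ in $\mathbb{D}$ satisfies $$B_p(\partial_{r}f)=B_p(\partial_{z}f)=B_p(\partial_{\overline{z}}f)=\infty.$$
   Context: $\mathbb{D}=\{z\in\mathbb{C}:|z|<1\}$, $\mathbb{T}=\partial\mathbb{D}$. Parameter set: $\Pi_3=\{(\alpha,p):-1<\alpha<0,\ -\frac1\alpha\le p\le\infty\}\cup\{(0,\infty)\}$. Poisson type integral: for $\alpha>-1$ and $F\in\mathcal{L}^1(\mathbb{T})$, $$\mathcal{K}_{\alpha}[F](z)=\frac{1}{2\pi}\int_{0}^{2\pi}\mathcal{K}_{\alpha}(ze^{-it})F(e^{it})\,dt,\quad \mathcal{K}_{\alpha}(z)=\mathcal{C}_{\alpha}\frac{(1-|z|^2)^{\alpha+1}}{|1-z|^{\alpha+2}},\quad \mathcal{C}_{\alpha}=\frac{\Gamma^2(1+\frac{\alpha}{2})}{\Gamma(1+\alpha)},\quad z\in\mathbb{D}.$$ Absolute continuity of $F$ on $\mathbb{T}$ refers to $\theta\mapsto F(e^{i\theta})$ on $[0,2\pi]$, and $\dot F(e^{i\theta})=\frac{d}{d\theta}F(e^{i\theta})$, which exists a.e. $\mathcal{L}^p(\mathbb{T})$ is the usual Lebesgue space on $\mathbb{T}$. Derivatives: $\partial_z=\frac12(\partial_x-i\partial_y)$, $\partial_{\overline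 z}=\frac12(\partial_x+i\partial_y)$, and for $z=re^{i\theta}$, $\partial_r f(z)=\partial_zf(z)e^{i\theta}+\partial_{\overline z}f(z)e^{-i\theta}$. For a measurable complex-valued $g$ on $\mathbb{D}$, $B_p(g)=\big(\int_{\mathbb{D}}|g(z)|^p\,d\sigma(z)\big)^{1/p}$ for $p<\infty$, where $d\sigma=dx\,dy/\pi$, and $B_\infty(g)=\operatorname{ess\,sup}_{z\in\mathbb{D}}|g(z)|$. *)

theory Defs
  imports "HOL-Analysis.Analysis" "HOL-Probability.Essential_Supremum"
begin

definition Pi3 :: "(real \<times> ennreal) set" where
  "Pi3 = {(\<alpha>, p). -1 < \<alpha> \<and> \<alpha> < 0 \<and> ennreal (- 1 / \<alpha>) \<le> p \<and> p \<le> \<infinity>} \<union> {(0, \<infinity>)}"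

abbreviation unit_disc :: "complex set" where
  "unit_disc \<equiv> ball 0 1"

definition absolutely_continuous_on_interval :: "real \<Rightarrow> real \<Rightarrow> (real \<Rightarrow> complex) \<Rightarrow> bool" where
  "absolutely_continuous_on_interval a b g \<longleftrightarrow>
     (\<forall>\<epsilon>>0. \<exists>\<delta>>0. \<forall>(n::nat) (x::nat \<Rightarrow> real) (y::nat \<Rightarrow> real).
        (\<forall>i<n. a \<le> x i \<and> x i \<le> y i \<and> y i \<le> b) \<and>
        disjoint_family_on (\<lambda>i. {x i<..<y i}) {..<n} \<and>
        (\<Sum>i<n. y i - x i) < \<delta> \<longrightarrow>
        (\<Sum>i<n. norm (g (y i) - g (x i))) < \<epsilon>)"

text \<open>A function on the unit circle is represented by a function on the complex plane of which
  only the values at the points \<^term>\<open>cis t\<close> are ever used.\<close>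

definition absolutely_continuous_circle :: "(complex \<Rightarrow> complex) \<Rightarrow> bool" where
  "absolutely_continuous_circle F \<longleftrightarrow>
     absolutely_continuous_on_interval 0 (2 * pi) (\<lambda>\<theta>. F (cis \<theta>))"

text \<open>\<open>circle_deriv F \<theta>\<close> is the angular derivative of \<open>F\<close> at the point \<^term>\<open>cis \<theta>\<close>. Where the derivative does
  not exist the value is arbitrary; for absolutely continuous \<open>F\<close> this is a null set of \<open>\<theta>\<close>.\<close>

definition circle_deriv :: "(complex \<Rightarrow> complex) \<Rightarrow> real \<Rightarrow> complex" where
  "circle_deriv F \<theta> = vector_derivative (\<lambda>t. F (cis t)) (at \<theta>)"

text \<open>Only used for \<open>a > 0\<close>.\<close>

definition ennreal_powr :: "ennreal \<Rightarrow> real \<Rightarrow> ennreal" where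
  "ennreal_powr x a = (if x = \<infinity> then \<infinity> else ennreal (enn2real x powr a))"

text \<open>Meant for measurable \<open>g\<close> and \<open>p > 0\<close>. The library sets \<^const>\<open>esssup\<close> of a
  non-measurable function to \<open>\<infinity>\<close>.\<close>

definition Lp_norm :: "'a measure \<Rightarrow> ennreal \<Rightarrow> ('a \<Rightarrow> complex) \<Rightarrow> ennreal" where
  "Lp_norm M p g =
     (if p = \<infinity> then esssup M (\<lambda>x. ennreal (norm (g x)))
      else ennreal_powr (\<integral>\<^sup>+ x. ennreal (norm (g x) powr enn2real p) \<partial>M) (1 / enn2real p))"

definition in_Lp :: "'a measure \<Rightarrow> ennreal \<Rightarrow> ('a \<Rightarrow> complex) \<Rightarrow> bool" where
  "in_Lp M p g \<longleftrightarrow> g \<in> borel_measurable M \<and> Lp_norm M p g < \<infinity>"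

text \<open>The measure \<open>d\<sigma> = dx dy / \<pi>\<close> on the unit disc.\<close>

definition disc_measure :: "complex measure" where
  "disc_measure = scale_measure (ennreal (1 / pi)) (lebesgue_on unit_disc)"

definition B_norm :: "ennreal \<Rightarrow> (complex \<Rightarrow> complex) \<Rightarrow> ennreal" where
  "B_norm p g = Lp_norm disc_measure p g"

definition C_const :: "real \<Rightarrow> real" where
  "C_const \<alpha> = (Gamma (1 + \<alpha> / 2))\<^sup>2 / Gamma (1 + \<alpha>)"

definition K_kernel :: "real \<Rightarrow> complex \<Rightarrow> real" where
  "K_kernel \<alpha> z =
     C_const \<alpha> * (1 - (norm z)\<^sup>2) powr (\<alpha> + 1) / norm (1 - z) powr (\<alpha> + 2)"

definition K_integral :: "real \<Rightarrow> (complex \<Rightarrow> complex) \<Rightarrow> complex \<Rightarrow> complex" where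
  "K_integral \<alpha> F z =
     1 / (2 * pi) *
     (LINT t | lebesgue_on {0..2 * pi}. complex_of_real (K_kernel \<alpha> (z * cis (- t))) * F (cis t))"

definition partial_x :: "(complex \<Rightarrow> complex) \<Rightarrow> complex \<Rightarrow> complex" where
  "partial_x f z = vector_derivative (\<lambda>x. f (Complex x (Im z))) (at (Re z))"

definition partial_y :: "(complex \<Rightarrow> complex) \<Rightarrow> complex \<Rightarrow> complex" where
  "partial_y f z = vector_derivative (\<lambda>y. f (Complex (Re z) y)) (at (Im z))"

definition partial_z :: "(complex \<Rightarrow> complex) \<Rightarrow> complex \<Rightarrow> complex" where
  "partial_z f z = 1 / 2 * (partial_x f z - \<i> * partial_y f z)"

definition partial_zbar :: "(complex \<Rightarrow> complex) \<Rightarrow> complex \<Rightarrow> complex" where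
  "partial_zbar f z = 1 / 2 * (partial_x f z + \<i> * partial_y f z)"

text \<open>The polar angle of \<open>z\<close> is \<^term>\<open>Arg z\<close>; the value at the origin (where the library sets the
  argument to 0) is a convention on a null set.\<close>

definition partial_r :: "(complex \<Rightarrow> complex) \<Rightarrow> complex \<Rightarrow> complex" where
  "partial_r f z = partial_z f z * cis (Arg z) + partial_zbar f z * cis (- Arg z)"

end

theory Submission
  imports Defs
begin

text \<open>
  For \<open>\<alpha> < 0\<close> the constant function \<open>F = 1\<close> is already an example: its angular derivative vanishes, but
  its integral is not constant. With \<open>s = 1 + \<alpha> / 2\<close>, Parseval's identity for the binomial series of
  \<open>(1 - z cis (- t)) powr (- s)\<close> shows that the integral is the radial function
  \<open>C (1 - x) powr (\<alpha> + 1) G x\<close> of \<open>x = |z|\<^sup>2\<close>, where \<open>G\<close> is the Gauss hypergeometric function with parameters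
  \<open>s, s; 1\<close> (\<open>K_integral_const\<close>). The derivative in \<open>x\<close> is \<open>C (1 - x) powr \<alpha>\<close> times
  \<open>(1 - x) G' - (\<alpha> + 1) G\<close>, and the last factor has a power series with nonnegative coefficients and
  constant term \<open>(\<alpha> / 2)\<^sup>2\<close> (\<open>hypergeom_derivative_bound\<close>). Hence all three derivatives of the integral
  are bounded below by a positive constant times \<open>|z| (1 - |z|\<^sup>2) powr \<alpha>\<close>. This function is not in the
  Lebesgue space of exponent \<open>p\<close> on the disc when \<open>\<alpha> p \<le> - 1\<close>, since \<open>1 / (1 - |z|\<^sup>2)\<close> is not integrable
  (\<open>B_norm_eq_top_of_boundary_growth\<close>).

  For \<open>\<alpha> = 0\<close> and \<open>p = \<infinity>\<close> the integral is the Poisson integral, and a Lipschitz function is wanted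
  whose harmonic extension has an unbounded gradient. A corner suffices: the angular derivative
  jumps there, and the conjugate function of a jump has a logarithmic singularity. Take \<open>F (cis t) = (t - pi)\<^sup>2\<close> on \<open>[0, 2 pi]\<close>, with a
  corner at \<open>1\<close>. Its Fourier coefficients are \<open>2 / k\<^sup>2\<close>, so its extension is a constant plus
  \<open>L + cnj L\<close> with \<open>L\<close> twice the dilogarithm (\<open>K_integral_0_parabola\<close>). From \<open>z L' = - 2 Ln (1 - z)\<close> the
  moduli of all three derivatives are at least \<open>- ln |1 - z|\<close>, which is unbounded near \<open>1\<close>.
\<close>


section \<open>Fourier coefficients on the circle\<close>

text \<open>The frequency is a real number, so that one integration lemma serves frequencies of both signs
  without coercions; only integer frequencies occur later.\<close>

definition fourier_coeff :: "(real \<Rightarrow> complex) \<Rightarrow> real \<Rightarrow> complex" where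
  "fourier_coeff H x = 1 / (2 * pi) * (LINT t | lebesgue_on {0..2 * pi}. cis (- (x * t)) * H t)"

lemma integrable_cis_mult:
  assumes "integrable (lebesgue_on {0..2 * pi}) H"
  shows "integrable (lebesgue_on {0..2 * pi}) (\<lambda>t. cis (x * t) * H t)"
proof (rule Bochner_Integration.integrable_bound[OF assms])
  have "(\<lambda>t. cis (x * t)) \<in> borel_measurable (lebesgue_on {0..2 * pi})"
    by (intro continuous_imp_measurable_on_sets_lebesgue) (auto intro!: continuous_intros)
  then show "(\<lambda>t. cis (x * t) * H t) \<in> borel_measurable (lebesgue_on {0..2 * pi})"
    using assms by measurable
qed (auto simp: norm_mult)

text \<open>Absolute summability allows integration term by term against any integrable function. The
  frequencies \<open>k n\<close> are free so that analytic (\<open>k n = n\<close>) and antianalytic (\<open>k n = - n\<close>) series are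
  covered together.\<close>

lemma
  assumes a: "summable (\<lambda>n. norm (a n))" and H: "integrable (lebesgue_on {0..2 * pi}) H"
  shows integrable_series_mult:
      "integrable (lebesgue_on {0..2 * pi}) (\<lambda>t. (\<Sum>n. a n * cis (- (k n * t))) * H t)"
    and fourier_pairing: "(\<lambda>n. a n * fourier_coeff H (k n)) sums
      (1 / (2 * pi) * (LINT t | lebesgue_on {0..2 * pi}. (\<Sum>n. a n * cis (- (k n * t))) * H t))"
proof -
  let ?M = "lebesgue_on {0..2 * pi}"
  let ?f = "\<lambda>n t. a n * (cis (- (k n * t)) * H t)"
  have int: "integrable ?M (?f n)" for n
    using integrable_cis_mult[OF H, of "- k n"] by simp
  have summ: "AE t in ?M. summable (\<lambda>n. norm (?f n t))"
    using a by (auto simp: norm_mult intro!: summable_mult2)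
  have summ': "summable (\<lambda>n. LINT t|?M. norm (?f n t))"
    using a by (auto simp: norm_mult intro!: summable_mult2)
  have eq: "(\<Sum>n. ?f n t) = (\<Sum>n. a n * cis (- (k n * t))) * H t" for t
  proof -
    have "summable (\<lambda>n. a n * cis (- (k n * t)))"
      using a by (intro summable_norm_cancel[where f = "\<lambda>n. a n * cis (- (k n * t))"])
        (simp add: norm_mult)
    from suminf_mult2[OF this, of "H t"] show ?thesis
      by (simp add: mult.assoc)
  qed
  show "integrable ?M (\<lambda>t. (\<Sum>n. a n * cis (- (k n * t))) * H t)"
    using integrable_suminf[OF int summ summ'] by (simp add: eq)
  have "(\<lambda>n. 1 / (2 * pi) * (LINT t|?M. ?f n t)) sums (1 / (2 * pi) * (LINT t|?M. (\<Sum>n. ?f n t)))"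
    by (intro sums_mult sums_integral int summ summ')
  moreover have "1 / (2 * pi) * (LINT t|?M. ?f n t) = a n * fourier_coeff H (k n)" for n
    by (simp add: fourier_coeff_def)
  ultimately show "(\<lambda>n. a n * fourier_coeff H (k n)) sums
      (1 / (2 * pi) * (LINT t | ?M. (\<Sum>n. a n * cis (- (k n * t))) * H t))"
    by (simp add: eq)
qed

text \<open>Every Fourier coefficient below is found by exhibiting an antiderivative \<open>W\<close>.\<close>

lemma fourier_coeff_eqI:
  assumes W: "\<And>t. t \<in> {0..2 * pi} \<Longrightarrow> (W has_vector_derivative cis (- (x * t)) * H t) (at t within {0..2*pi})"
    and H: "integrable (lebesgue_on {0..2 * pi}) H"
  shows "fourier_coeff H x = (W (2 * pi) - W 0) / (2 * pi)"
proof -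
  have "((\<lambda>t. cis (- (x * t)) * H t) has_integral (W (2 * pi) - W 0)) {0..2 * pi}"
    by (intro fundamental_theorem_of_calculus W) auto
  moreover have "integrable (lebesgue_on {0..2 * pi}) (\<lambda>t. cis (- (x * t)) * H t)"
    using integrable_cis_mult[OF H, of "- x"] by simp
  ultimately show ?thesis
    by (simp add: fourier_coeff_def lebesgue_integral_eq_integral integral_unique)
qed

lemma integrable_continuous_circle:
  assumes "continuous_on {0..2 * pi} (H :: real \<Rightarrow> complex)"
  shows "integrable (lebesgue_on {0..2 * pi}) H"
  using continuous_imp_integrable_real[OF assms] .

lemma fourier_coeff_cis:
  assumes "m \<in> \<int>" "k \<in> \<int>"
  shows "fourier_coeff (\<lambda>t. cis (- (m * t))) k = (if m + k = 0 then 1 else 0)"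
proof -
  have int: "integrable (lebesgue_on {0..2 * pi}) (\<lambda>t. cis (- (m * t)))"
    by (intro integrable_continuous_circle continuous_intros)
  show ?thesis
  proof (cases "m + k = 0")
    case True
    have "((\<lambda>t. complex_of_real t) has_vector_derivative cis (- (k * t)) * cis (- (m * t))) (at t within {0..2*pi})"
      for t
    proof -
      have "- (k * t) + - (m * t) = 0"
        using True by (metis add.commute distrib_right mult_zero_left minus_add_distrib neg_equal_0_iff_equal)
      then have "cis (- (k * t)) * cis (- (m * t)) = 1"
        by (simp only: cis_mult cis_zero)
      then show ?thesis
        by (auto intro!: derivative_eq_intros)
    qed
    from fourier_coeff_eqI[of complex_of_real, OF this int] True show ?thesis
      by simp
  next
    case False
    define j where "j = m + k"
    have j: "j \<noteq> 0" using False by (simp add: j_def)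
    have mult: "cis (- (k * t)) * cis (- (m * t)) = cis (- (j * t))" for t
      by (simp add: cis_mult j_def algebra_simps)
    have "((\<lambda>t. \<i> / of_real j * cis (- (j * t))) has_vector_derivative cis (- (k * t)) * cis (- (m * t)))
        (at t within {0..2*pi})" for t
    proof -
      have "((\<lambda>t. cis (- (j * t))) has_vector_derivative - j *\<^sub>R (\<i> * cis (- (j * t))))
          (at t within {0..2*pi})"
        unfolding has_vector_derivative_def
        by (rule has_derivative_eq_rhs, rule has_derivative_cis, rule derivative_intros,
            rule has_derivative_mult_right, rule has_derivative_ident)
          (simp add: fun_eq_iff scaleR_conv_of_real algebra_simps)
      from has_vector_derivative_mult_right[OF this, of "\<i> / of_real j"] show ?thesis
        using j unfolding mult by (simp add: scaleR_conv_of_real field_simps)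
    qed
    from fourier_coeff_eqI[OF this int] have "fourier_coeff (\<lambda>t. cis (- (m * t))) k =
        (\<i> / of_real j * cis (- (j * (2 * pi))) - \<i> / of_real j) / (2 * pi)"
      by simp
    also have "cis (- (j * (2 * pi))) = 1"
    proof -
      have "- (j * (2 * pi)) = 2 * pi * (- m - k)" by (simp add: j_def algebra_simps)
      then show ?thesis using assms by (simp only: cis_multiple_2pi Ints_minus Ints_diff)
    qed
    finally show ?thesis using False by simp
  qed
qed

lemma cnj_suminf: "summable f \<Longrightarrow> cnj (\<Sum>n. f n) = (\<Sum>n. cnj (f n))"
  by (metis sums_cnj summable_sums sums_unique)

text \<open>The pairing formula is used twice: expanding the first factor leaves the Fourier coefficients
  of the second, and expanding the second one reduces those to the orthogonality of characters.\<close>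

lemma parseval_series:
  assumes a: "summable (\<lambda>n. norm (a n))" and b: "summable (\<lambda>n. norm (b n))"
  shows "(\<lambda>n. a n * cnj (b n)) sums (1 / (2 * pi) * (LINT t | lebesgue_on {0..2 * pi}.
           (\<Sum>n. a n * cis (- (real n * t))) * cnj (\<Sum>n. b n * cis (- (real n * t)))))"
proof -
  let ?M = "lebesgue_on {0..2 * pi}"
  let ?B = "\<lambda>t. cnj (\<Sum>n. b n * cis (- (real n * t)))"
  have B: "?B t = (\<Sum>n. cnj (b n) * cis (- (- real n * t)))" for t
  proof -
    have "summable (\<lambda>n. norm (b n * cis (- (real n * t))))"
      using b by (simp add: norm_mult)
    from cnj_suminf[OF summable_norm_cancel[OF this]] show ?thesis
      by (simp add: cis_cnj)
  qed
  have cb: "summable (\<lambda>n. norm (cnj (b n)))"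
    using b by simp
  have "integrable ?M (\<lambda>t. 1)" by simp
  from integrable_series_mult[OF cb this, of "\<lambda>n. - real n"]
  have intB: "integrable ?M ?B" by (simp only: B mult_1_right)
  have coeff: "fourier_coeff ?B (real n) = cnj (b n)" for n
  proof -
    have "integrable ?M (\<lambda>t. cis (- (real n * t)))"
      by (intro integrable_continuous_circle continuous_intros)
    note pairing = fourier_pairing[OF cb this, of "\<lambda>n. - real n"]
    have comm: "(\<Sum>m. cnj (b m) * cis (- (- real m * t))) * cis (- (real n * t)) = cis (- (real n * t)) * ?B t" for t
      by (subst B) (rule mult.commute)
    from pairing
    have "(\<lambda>m. cnj (b m) * fourier_coeff (\<lambda>t. cis (- (real n * t))) (- real m)) sums fourier_coeff ?B n"
      unfolding comm fourier_coeff_def .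
    moreover have "cnj (b m) * fourier_coeff (\<lambda>t. cis (- (real n * t))) (- real m) = (if m = n then cnj (b m) else 0)" for m
      by (subst fourier_coeff_cis) auto
    ultimately have "(\<lambda>m. if m = n then cnj (b m) else 0) sums fourier_coeff ?B n" by simp
    then show ?thesis using sums_single[of n "\<lambda>m. cnj (b m)"] sums_unique2 by blast
  qed
  show ?thesis
    using fourier_pairing[OF a intB, of real] by (simp add: coeff)
qed

section \<open>Wirtinger derivatives\<close>

text \<open>A real linear map of the plane is uniquely \<open>a h + b cnj h\<close>, and evaluating it in the directions
  \<open>1\<close> and \<open>\<i>\<close> gives \<open>a + b\<close> and \<open>\<i> (a - b)\<close>.\<close>

lemma wirtinger_derivatives:
  assumes "(f has_derivative (\<lambda>h. a * h + b * cnj h)) (at z)"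
  shows "partial_z f z = a" "partial_zbar f z = b"
proof -
  have f: "(f has_derivative (\<lambda>h. a * h + b * cnj h)) (at (Complex (Re z) (Im z)))"
    using assms by simp
  have "((\<lambda>x. f (Complex x (Im z))) has_derivative (\<lambda>h. a * Complex h 0 + b * cnj (Complex h 0))) (at (Re z))"
    by (rule has_derivative_compose[where f = "\<lambda>x. Complex x (Im z)" and g = f, OF _ f])
      (auto simp: Complex_eq intro!: derivative_eq_intros)
  then have "((\<lambda>x. f (Complex x (Im z))) has_vector_derivative (a + b)) (at (Re z))"
    by (simp add: has_vector_derivative_def scaleR_conv_of_real Complex_eq algebra_simps)
  then have x: "partial_x f z = a + b"
    unfolding partial_x_def by (rule vector_derivative_at)
  have "((\<lambda>y. f (Complex (Re z) y)) has_derivative (\<lambda>h. a * Complex 0 h + b * cnj (Complex 0 h))) (at (Im z))"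
    by (rule has_derivative_compose[where f = "\<lambda>y. Complex (Re z) y" and g = f, OF _ f])
      (auto simp: Complex_eq intro!: derivative_eq_intros)
  then have "((\<lambda>y. f (Complex (Re z) y)) has_vector_derivative (\<i> * (a - b))) (at (Im z))"
    by (simp add: has_vector_derivative_def scaleR_conv_of_real Complex_eq algebra_simps)
  then have y: "partial_y f z = \<i> * (a - b)"
    unfolding partial_y_def by (rule vector_derivative_at)
  show "partial_z f z = a" "partial_zbar f z = b"
    by (simp_all add: partial_z_def partial_zbar_def x y algebra_simps)
qed

text \<open>Multiplying by \<open>|z|\<close> replaces the polar angle by \<open>z\<close> itself, since \<open>|z| cis (Arg z) = z\<close>.\<close>

lemma norm_mult_partial_r:
  "norm z * norm (partial_r f z) = norm (z * partial_z f z + cnj z * partial_zbar f z)"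
proof (cases "z = 0")
  case False
  have "cis (- Arg z) = cnj (sgn z)" "cis (Arg z) = sgn z"
    using False by (auto simp: cis_Arg simp flip: cis_cnj)
  then have "of_real (norm z) * partial_r f z = z * partial_z f z + cnj z * partial_zbar f z"
    using False by (simp add: partial_r_def sgn_eq field_simps)
  then show ?thesis
    by (metis norm_mult norm_of_real abs_norm_cancel)
qed simp

section \<open>Criteria for infinite norms\<close>

lemma sets_disc_measureI: "A \<in> sets lebesgue \<Longrightarrow> A \<subseteq> unit_disc \<Longrightarrow> A \<in> sets disc_measure"
  by (auto simp: disc_measure_def sets_restrict_space)

lemma emeasure_disc_measure_ball:
  assumes "0 \<le> r" "r \<le> 1"
  shows "emeasure disc_measure (ball 0 r) = ennreal (r\<^sup>2)"
proof -
  have "emeasure (lebesgue_on unit_disc) (ball 0 r) = emeasure lborel (ball (0::complex) r)"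
    using assms by (subst emeasure_restrict_space) auto
  also have "\<dots> = ennreal (pi * r\<^sup>2)"
    using assms unit_ball_vol_even[of 1] by (subst emeasure_ball) (auto simp: DIM_complex)
  finally show ?thesis
    using assms by (simp add: disc_measure_def flip: ennreal_mult)
qed

text \<open>A finite essential supremum would bound \<open>g\<close> almost everywhere, but the nonempty open set on
  which \<open>g\<close> exceeds this bound has positive measure.\<close>

lemma B_norm_top_eq_top:
  assumes "\<And>M. \<exists>U. open U \<and> U \<noteq> {} \<and> U \<subseteq> unit_disc \<and> (\<forall>z\<in>U. M \<le> norm (g z))"
  shows "B_norm \<infinity> g = \<infinity>"
proof (rule ccontr)
  assume "B_norm \<infinity> g \<noteq> \<infinity>"
  then have fin: "esssup disc_measure (\<lambda>z. ennreal (norm (g z))) \<noteq> top"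
    by (simp add: B_norm_def Lp_norm_def)
  then obtain m where m: "m \<ge> 0" "esssup disc_measure (\<lambda>z. ennreal (norm (g z))) = ennreal m"
    by (cases "esssup disc_measure (\<lambda>z. ennreal (norm (g z)))") auto
  have AE: "AE z in disc_measure. norm (g z) \<le> m"
    using esssup_AE[where M = disc_measure and f = "\<lambda>z. ennreal (norm (g z))"] m by simp
  obtain U where U: "open U" "U \<noteq> {}" "U \<subseteq> unit_disc" "\<And>z. z \<in> U \<Longrightarrow> m + 1 \<le> norm (g z)"
    using assms[of "m + 1"] by blast
  have meas: "U \<in> sets disc_measure"
    using U by (intro sets_disc_measureI) auto
  have "AE z in disc_measure. z \<notin> U"
    using AE by eventually_elim (use U(4) in force)
  then have "emeasure disc_measure U = 0"
    using meas sets.sets_into_space[OF meas] by (subst (asm) AE_iff_measurable[of U]) auto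
  moreover have "emeasure disc_measure U = ennreal (1 / pi) * emeasure lborel U"
    using U by (simp add: disc_measure_def emeasure_restrict_space)
  ultimately have "emeasure lborel U = 0" by simp
  then show False
    using U open_not_negligible[of U] by (auto simp: negligible_iff_null_sets null_sets_def)
qed

text \<open>The disc is cut into annuli \<open>1 - 1 / 2 ^ (k + 1) \<le> |z|\<^sup>2 < 1 - 1 / 2 ^ (k + 2)\<close>. The normalised area of
  the \<open>k\<close>-th one is \<open>1 / 2 ^ (k + 2)\<close>, while \<open>1 / (1 - |z|\<^sup>2)\<close> is at least \<open>2 ^ (k + 1)\<close> there, so that
  each annulus contributes at least the same positive constant.\<close>

lemma nn_integral_disc_inverse_eq_top:
  assumes c: "c > 0" and h: "\<And>z. 1 / 2 \<le> norm z \<Longrightarrow> norm z < 1 \<Longrightarrow> ennreal (c / (1 - (norm z)\<^sup>2)) \<le> h z"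
  shows "(\<integral>\<^sup>+ z. h z \<partial>disc_measure) = \<infinity>"
proof -
  define r :: "nat \<Rightarrow> real" where "r k = sqrt (1 - 1 / 2 ^ Suc k)" for k
  define A where "A k = ball (0::complex) (r (Suc k)) - ball 0 (r k)" for k
  have le: "1 / 2 ^ Suc k \<le> (1 / 2 :: real)" for k
    using power_increasing[of 1 "Suc k" "2::real"] by (intro divide_left_mono) auto
  have rsq: "(r k)\<^sup>2 = 1 - 1 / 2 ^ Suc k" for k
    unfolding r_def using le[of k] by (intro real_sqrt_pow2) (simp del: power_Suc)
  have r0: "0 \<le> r k" for k
    unfolding r_def using le[of k] by (simp del: power_Suc)
  have r1: "r k < 1" for k unfolding r_def by (simp del: power_Suc)
  have rh: "1 / 2 \<le> r k" for k
  proof (rule power2_le_imp_le[OF _ r0])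
    have "(1 / 2 :: real)\<^sup>2 \<le> 1 / 2" by (simp add: power2_eq_square)
    then show "(1 / 2)\<^sup>2 \<le> (r k)\<^sup>2" using rsq[of k] le[of k] by linarith
  qed
  have rmono: "r k \<le> r j" if "k \<le> j" for k j
    unfolding r_def using that by (intro real_sqrt_le_mono) (auto simp: field_simps)
  have disj: "disjoint_family A"
    unfolding disjoint_family_on_def
  proof (intro ballI impI)
    have *: "A i \<inter> A j = {}" if "i < j" for i j
      using rmono[of "Suc i" j] that by (auto simp: A_def)
    show "A i \<inter> A j = {}" if "i \<noteq> j" for i j
      using *[of i j] *[of j i] that by (cases i j rule: linorder_cases) auto
  qed
  have meas: "A k \<in> sets disc_measure" for k
    unfolding A_def by (intro sets_disc_measureI) (auto intro: less_trans[OF _ r1])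
  have A: "emeasure disc_measure (A k) = ennreal (1 / 2 ^ (k + 2))" for k
  proof -
    have "emeasure disc_measure (A k) = emeasure disc_measure (ball 0 (r (Suc k))) - emeasure disc_measure (ball 0 (r k))"
      unfolding A_def
    proof (rule emeasure_Diff)
      show "ball 0 (r (Suc k)) \<in> sets disc_measure" "ball 0 (r k) \<in> sets disc_measure"
        by (intro sets_disc_measureI; auto intro: less_trans[OF _ r1])+
    qed (use rmono[of k "Suc k"] emeasure_disc_measure_ball[OF r0 less_imp_le[OF r1]] in auto)
    also have "\<dots> = ennreal ((r (Suc k))\<^sup>2 - (r k)\<^sup>2)"
      by (simp add: emeasure_disc_measure_ball r0 less_imp_le[OF r1] ennreal_minus)
    also have "(r (Suc k))\<^sup>2 - (r k)\<^sup>2 = 1 / 2 ^ (k + 2)"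
      unfolding rsq by (simp add: field_simps)
    finally show ?thesis .
  qed
  have "(\<integral>\<^sup>+ z. (\<Sum>k. ennreal (c * 2 ^ Suc k) * indicator (A k) z) \<partial>disc_measure)
      = (\<Sum>k. \<integral>\<^sup>+ z. ennreal (c * 2 ^ Suc k) * indicator (A k) z \<partial>disc_measure)"
    using meas by (intro nn_integral_suminf) auto
  also have "\<dots> = (\<Sum>k. ennreal (c * 2 ^ Suc k) * ennreal (1 / 2 ^ (k + 2)))"
    using meas by (simp add: nn_integral_cmult_indicator A)
  also have "\<dots> = (\<Sum>k::nat. ennreal (c / 2))"
    using c by (intro suminf_cong) (simp flip: ennreal_mult)
  also have "\<dots> = \<infinity>"
  proof (rule ccontr)
    assume "(\<Sum>k::nat. ennreal (c / 2)) \<noteq> \<infinity>"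
    then have "summable (\<lambda>k::nat. c / 2)"
      using c by (intro summable_suminf_not_top) auto
    then show False using c by (simp add: summable_const_iff)
  qed
  finally have "\<infinity> \<le> (\<integral>\<^sup>+ z. (\<Sum>k. ennreal (c * 2 ^ Suc k) * indicator (A k) z) \<partial>disc_measure)"
    by simp
  also have "\<dots> \<le> (\<integral>\<^sup>+ z. h z \<partial>disc_measure)"
  proof (rule nn_integral_mono)
    fix z
    show "(\<Sum>k. ennreal (c * 2 ^ Suc k) * indicator (A k) z) \<le> h z"
    proof (cases "\<exists>j. z \<in> A j")
      case True
      then obtain j where j: "z \<in> A j" by blast
      then have z: "r j \<le> norm z" "norm z < r (Suc j)" by (auto simp: A_def)
      then have z1: "norm z < 1" "1 / 2 \<le> norm z"
        using r1[of "Suc j"] rh[of j] by linarith+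
      have "(r j)\<^sup>2 \<le> (norm z)\<^sup>2" using z r0 by (intro power_mono) auto
      moreover have "(norm z)\<^sup>2 < 1" using z1 by (simp add: abs_square_less_1)
      ultimately have "2 ^ Suc j \<le> 1 / (1 - (norm z)\<^sup>2)"
        by (simp add: rsq field_simps)
      then have "c * 2 ^ Suc j \<le> c / (1 - (norm z)\<^sup>2)"
        using mult_left_mono[OF _ less_imp_le[OF c]] by fastforce
      then have "ennreal (c * 2 ^ Suc j) \<le> h z"
        using h[OF z1(2,1)] by (meson ennreal_leI order_trans)
      then show ?thesis
        using suminf_cmult_indicator[OF disj j, of "\<lambda>k. ennreal (c * 2 ^ Suc k)"] by simp
    next
      case False
      then show ?thesis by simp
    qed
  qed
  finally show ?thesis by (simp add: top_unique)
qed

text \<open>The condition \<open>p \<ge> - 1 / \<alpha>\<close> is exactly \<open>\<alpha> p \<le> - 1\<close>, which is what makes \<open>(1 - |z|\<^sup>2) powr (\<alpha> p)\<close>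
  at least as large as the non-integrable function \<open>1 / (1 - |z|\<^sup>2)\<close>. The factor \<open>|z|\<close>, which comes
  from the vanishing of a radial gradient at the origin, is harmless near the circle.\<close>

lemma B_norm_eq_top_of_boundary_growth:
  fixes \<alpha> c :: real
  assumes \<alpha>: "\<alpha> < 0" and p: "ennreal (- 1 / \<alpha>) \<le> p" and c: "c > 0"
    and g: "\<And>z. norm z < 1 \<Longrightarrow> c * norm z * (1 - (norm z)\<^sup>2) powr \<alpha> \<le> norm (g z)"
  shows "B_norm p g = \<infinity>"
proof -
  have g': "c / 2 * (1 - (norm z)\<^sup>2) powr \<alpha> \<le> norm (g z)" if "norm z < 1" "1 / 2 \<le> norm z" for z
  proof -
    have "c * (1 / 2) * (1 - (norm z)\<^sup>2) powr \<alpha> \<le> c * norm z * (1 - (norm z)\<^sup>2) powr \<alpha>"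
      using that c by (intro mult_right_mono mult_left_mono) auto
    then show ?thesis using g[OF that(1)] by simp
  qed
  show ?thesis
  proof (cases "p = \<infinity>")
    case True
    have "\<exists>U. open U \<and> U \<noteq> {} \<and> U \<subseteq> unit_disc \<and> (\<forall>z\<in>U. M \<le> norm (g z))" for M
    proof -
      \<comment> \<open>\<open>1 - |z|\<^sup>2 \<le> e\<close> forces \<open>(1 - |z|\<^sup>2) powr \<alpha> \<ge> 2 M / c\<close>, because \<open>\<alpha> < 0\<close>.\<close>
      define e where "e = (max (2 * M / c) 1) powr (1 / \<alpha>)"
      have e: "0 < e" "e powr \<alpha> = max (2 * M / c) 1"
        using \<alpha> by (auto simp: e_def powr_powr)
      define \<rho> where "\<rho> = max (1 / 2) (sqrt (max 0 (1 - e)))"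
      have \<rho>: "1 / 2 \<le> \<rho>" "\<rho> < 1" "1 - e \<le> \<rho>\<^sup>2"
      proof -
        show "1 / 2 \<le> \<rho>" "\<rho> < 1" using e by (auto simp: \<rho>_def)
        have "max 0 (1 - e) = (sqrt (max 0 (1 - e)))\<^sup>2" by simp
        also have "\<dots> \<le> \<rho>\<^sup>2" by (intro power_mono) (auto simp: \<rho>_def)
        finally show "1 - e \<le> \<rho>\<^sup>2" by simp
      qed
      define U where "U = unit_disc - cball (0::complex) \<rho>"
      have "open U" unfolding U_def by (intro open_Diff) auto
      moreover have "of_real ((1 + \<rho>) / 2) \<in> U"
        using \<rho> by (simp add: U_def del: of_real_divide of_real_add)
      moreover have "M \<le> norm (g z)" if "z \<in> U" for z
      proof -
        have z: "\<rho> < norm z" "norm z < 1" using that by (auto simp: U_def)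
        have "\<rho>\<^sup>2 \<le> (norm z)\<^sup>2" using z \<rho> by (intro power_mono) auto
        then have "1 - (norm z)\<^sup>2 \<le> e" using \<rho> by linarith
        moreover have "0 < 1 - (norm z)\<^sup>2" using z by (simp add: abs_square_less_1)
        ultimately have "e powr \<alpha> \<le> (1 - (norm z)\<^sup>2) powr \<alpha>"
          using \<alpha> e by (intro powr_mono2') auto
        then have "2 * M / c \<le> (1 - (norm z)\<^sup>2) powr \<alpha>" using e by simp
        then have "M \<le> c / 2 * (1 - (norm z)\<^sup>2) powr \<alpha>"
          using c by (simp add: field_simps)
        then show ?thesis using g'[of z] z \<rho> by simp
      qed
      moreover have "U \<subseteq> unit_disc" by (auto simp: U_def)
      ultimately show ?thesis by (intro exI[of _ U] conjI ballI) auto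
    qed
    then show ?thesis unfolding True by (rule B_norm_top_eq_top)
  next
    case False
    then obtain q where q: "q \<ge> 0" "p = ennreal q" by (cases p) auto
    then have q': "- 1 / \<alpha> \<le> q" using p by (simp add: ennreal_le_iff)
    then have "\<alpha> * q \<le> - 1" using \<alpha> by (simp add: field_simps)
    have "(\<integral>\<^sup>+ z. ennreal (norm (g z) powr q) \<partial>disc_measure) = \<infinity>"
    proof (rule nn_integral_disc_inverse_eq_top)
      show "(c / 2) powr q > 0" using c by simp
      fix z :: complex assume z: "1 / 2 \<le> norm z" "norm z < 1"
      then have x: "0 < 1 - (norm z)\<^sup>2" by (simp add: abs_square_less_1)
      have "(1 - (norm z)\<^sup>2) powr (- 1) \<le> (1 - (norm z)\<^sup>2) powr (\<alpha> * q)"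
        using x \<open>\<alpha> * q \<le> - 1\<close> by (intro powr_mono') auto
      then have "1 / (1 - (norm z)\<^sup>2) \<le> (1 - (norm z)\<^sup>2) powr (\<alpha> * q)"
        using x by (simp only: powr_minus_divide powr_one)
      from mult_left_mono[OF this, of "(c / 2) powr q"]
      have "(c / 2) powr q / (1 - (norm z)\<^sup>2) \<le> (c / 2) powr q * (1 - (norm z)\<^sup>2) powr (\<alpha> * q)"
        by simp
      also have "\<dots> = (c / 2 * (1 - (norm z)\<^sup>2) powr \<alpha>) powr q"
        using c by (subst powr_mult) (simp_all add: powr_powr)
      also have "\<dots> \<le> norm (g z) powr q"
        using g'[OF z(2,1)] c q by (intro powr_mono2) auto
      finally show "ennreal ((c / 2) powr q / (1 - (norm z)\<^sup>2)) \<le> ennreal (norm (g z) powr q)"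
        by (rule ennreal_leI)
    qed
    then show ?thesis
      using q by (simp add: B_norm_def Lp_norm_def ennreal_powr_def)
  qed
qed

section \<open>The hypergeometric profile of the integral of a constant\<close>

text \<open>The coefficients of \<open>(1 - w) powr (- s)\<close>.\<close>

definition binom_coeff :: "real \<Rightarrow> nat \<Rightarrow> real" where
  "binom_coeff s n = pochhammer s n / fact n"

text \<open>The Gauss hypergeometric function with parameters \<open>s, s; 1\<close>.\<close>

definition hypergeom :: "real \<Rightarrow> real \<Rightarrow> real" where
  "hypergeom s x = (\<Sum>n. (binom_coeff s n)\<^sup>2 * x ^ n)"

lemma binom_coeff_nonneg: "s > 0 \<Longrightarrow> binom_coeff s n \<ge> 0"
  by (simp add: binom_coeff_def pochhammer_nonneg)

lemma binom_coeff_Suc: "binom_coeff s (Suc n) = binom_coeff s n * ((s + n) / (n + 1))"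
  by (simp add: binom_coeff_def pochhammer_Suc field_simps)

lemma cis_minus_power: "cis (- t) ^ n = cis (- (real n * t))"
  using Complex.DeMoivre[of "- t" n] by (simp only: mult_minus_right)

lemma gbinomial_minus_eq_binom_coeff:
  fixes w :: complex
  shows "(- complex_of_real s gchoose n) * (- w) ^ n = of_real (binom_coeff s n) * w ^ n"
proof -
  have "(- complex_of_real s gchoose n) * (- w) ^ n
      = ((-1) * (-1)) ^ n * (pochhammer (of_real s) n / fact n * w ^ n)"
    by (simp only: gbinomial_pochhammer minus_minus power_mult_distrib power_minus[of w] times_divide_eq_left mult_ac
        times_divide_eq_right)
  also have "\<dots> = of_real (binom_coeff s n) * w ^ n"
    by (simp add: binom_coeff_def pochhammer_of_real)
  finally show ?thesis .
qed

lemma binomial_series: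
  fixes w :: complex
  assumes "norm w < 1"
  shows "(\<lambda>n. of_real (binom_coeff s n) * w ^ n) sums ((1 - w) powr (- of_real s))"
  using gen_binomial_complex[of "- w" "- of_real s"] assms
  by (simp add: gbinomial_minus_eq_binom_coeff)

lemma summable_norm_binomial_series:
  assumes "s > 0" "norm w < 1"
  shows "summable (\<lambda>n. norm (of_real (binom_coeff s n) * w ^ n :: complex))"
proof -
  have "(\<lambda>n. complex_of_real (binom_coeff s n * norm w ^ n)) sums ((1 - of_real (norm w)) powr (- of_real s))"
    using binomial_series[of "of_real (norm w)" s] assms by simp
  then have "summable (\<lambda>n. complex_of_real (binom_coeff s n * norm w ^ n))"
    by (rule sums_summable)
  then have "summable (\<lambda>n. binom_coeff s n * norm w ^ n)"
    by (simp only: summable_of_real_iff)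
  then show ?thesis
    using assms by (simp add: norm_mult norm_power binom_coeff_nonneg)
qed

text \<open>Parseval applied to \<open>(1 - z cis (- t)) powr (- s)\<close>, whose squared modulus is the integrand.\<close>

lemma hypergeom_sums:
  assumes s: "s > 0" and z: "norm z < 1"
  shows "(\<lambda>n. (binom_coeff s n)\<^sup>2 * ((norm z)\<^sup>2) ^ n) sums
     (1 / (2 * pi) * (LINT t | lebesgue_on {0..2 * pi}. norm (1 - z * cis (- t)) powr (- 2 * s)))"
proof -
  let ?a = "\<lambda>n. of_real (binom_coeff s n) * z ^ n"
  have series: "(\<Sum>n. ?a n * cis (- (real n * t))) = (1 - z * cis (- t)) powr (- of_real s)" for t
  proof -
    have "?a n * cis (- (real n * t)) = of_real (binom_coeff s n) * (z * cis (- t)) ^ n" for n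
      by (simp add: power_mult_distrib cis_minus_power)
    moreover have "norm (z * cis (- t)) < 1" using z by (simp add: norm_mult)
    ultimately show ?thesis
      using sums_unique[OF binomial_series[of "z * cis (- t)" s]] by (simp only:)
  qed
  have sq: "w * cnj w = of_real (norm (1 - z * cis (- t)) powr (- 2 * s))"
    if "w = (1 - z * cis (- t)) powr (- of_real s)" for w t
  proof -
    have "norm w = norm (1 - z * cis (- t)) powr (- s)"
      unfolding that by (subst norm_powr_real_powr') auto
    then have "(norm w)\<^sup>2 = norm (1 - z * cis (- t)) powr (- 2 * s)"
      by (simp add: power2_eq_square flip: powr_add)
    then show ?thesis by (metis complex_norm_square)
  qed
  have norm_sq: "?a n * cnj (?a n) = complex_of_real ((binom_coeff s n)\<^sup>2 * ((norm z)\<^sup>2) ^ n)" for n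
  proof -
    have "?a n * cnj (?a n) = of_real ((norm (?a n))\<^sup>2)"
      by (rule complex_norm_square[symmetric])
    also have "(norm (?a n))\<^sup>2 = (binom_coeff s n)\<^sup>2 * ((norm z)\<^sup>2) ^ n"
      by (simp add: norm_mult norm_power power_mult_distrib power2_eq_square)
    finally show ?thesis .
  qed
  have "(\<lambda>n. ?a n * cnj (?a n)) sums (1 / (2 * pi) * (LINT t | lebesgue_on {0..2 * pi}.
      (\<Sum>n. ?a n * cis (- (real n * t))) * cnj (\<Sum>n. ?a n * cis (- (real n * t)))))"
    using summable_norm_binomial_series[OF s z] by (intro parseval_series)
  also have "(\<lambda>t. (\<Sum>n. ?a n * cis (- (real n * t))) * cnj (\<Sum>n. ?a n * cis (- (real n * t))))
      = (\<lambda>t. complex_of_real (norm (1 - z * cis (- t)) powr (- 2 * s)))"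
    by (rule ext, rule sq, rule series)
  finally have "(\<lambda>n. complex_of_real ((binom_coeff s n)\<^sup>2 * ((norm z)\<^sup>2) ^ n)) sums
      of_real (1 / (2 * pi) * (LINT t | lebesgue_on {0..2 * pi}. norm (1 - z * cis (- t)) powr (- 2 * s)))"
    unfolding norm_sq integral_complex_of_real by simp
  then show ?thesis by (simp only: sums_of_real_iff)
qed

lemma summable_hypergeom:
  assumes "s > 0" "norm (x :: real) < 1"
  shows "summable (\<lambda>n. (binom_coeff s n)\<^sup>2 * x ^ n)"
proof -
  have "norm (of_real (sqrt \<bar>x\<bar>) :: complex) < 1" using assms by simp
  from sums_summable[OF hypergeom_sums[OF assms(1) this]]
  have "summable (\<lambda>n. (binom_coeff s n)\<^sup>2 * \<bar>x\<bar> ^ n)" by simp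
  then show ?thesis
    by (intro summable_norm_cancel[where f = "\<lambda>n. (binom_coeff s n)\<^sup>2 * x ^ n"])
      (simp add: abs_mult power_abs)
qed

text \<open>The kernel is a power of \<open>|1 - z cis (- t)|\<close> with exponent \<open>- 2 s\<close> for \<open>s = 1 + \<alpha> / 2\<close>, up to a
  factor that depends on \<open>|z|\<close> only.\<close>

lemma K_integral_const:
  assumes \<alpha>: "\<alpha> > - 1" and z: "norm z < 1"
  shows "K_integral \<alpha> (\<lambda>_. 1) z
    = of_real (C_const \<alpha> * (1 - (norm z)\<^sup>2) powr (\<alpha> + 1) * hypergeom (1 + \<alpha> / 2) ((norm z)\<^sup>2))"
proof -
  have kernel: "K_kernel \<alpha> (z * cis (- t)) = C_const \<alpha> * (1 - (norm z)\<^sup>2) powr (\<alpha> + 1)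
      * norm (1 - z * cis (- t)) powr (- 2 * (1 + \<alpha> / 2))" for t
  proof -
    have "- 2 * (1 + \<alpha> / 2) = - (\<alpha> + 2)" by simp
    then show ?thesis
      by (simp only: powr_minus_divide) (simp add: K_kernel_def norm_mult)
  qed
  have "hypergeom (1 + \<alpha> / 2) ((norm z)\<^sup>2)
      = 1 / (2 * pi) * (LINT t | lebesgue_on {0..2 * pi}. norm (1 - z * cis (- t)) powr (- 2 * (1 + \<alpha> / 2)))"
    unfolding hypergeom_def using \<alpha> hypergeom_sums[of "1 + \<alpha> / 2" z] z by (simp only: sums_iff)
  then show ?thesis
    unfolding K_integral_def kernel mult_1_right integral_complex_of_real integral_mult_right_zero
    by simp
qed

text \<open>The right-hand side is \<open>(1 - x) powr (2 - 2 s)\<close> times the derivative of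
  \<open>(1 - x) powr (2 s - 1) * hypergeom s x\<close>. The recurrence of the coefficients \<open>a n\<close> turns it into the
  power series with coefficients \<open>(1 - s)\<^sup>2 / (n + 1) * a n\<close>. These are nonnegative, and the constant
  term alone is \<open>(1 - s)\<^sup>2\<close>. For \<open>s = 1 + \<alpha> / 2\<close> the derivative is therefore at least of
  order \<open>(1 - x) powr \<alpha>\<close>.\<close>

lemma hypergeom_derivative_bound:
  assumes s: "s > 0" and x: "0 \<le> x" "x < 1"
  obtains D where "(hypergeom s has_real_derivative D) (at x)"
    "(1 - s)\<^sup>2 \<le> (1 - x) * D - (2 * s - 1) * hypergeom s x"
proof
  let ?a = "\<lambda>n. (binom_coeff s n)\<^sup>2"
  define D where "D = (\<Sum>n. diffs ?a n * x ^ n)"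
  show "(hypergeom s has_real_derivative D) (at x)"
    unfolding hypergeom_def[abs_def] D_def
    by (rule termdiffs_strong'[where K = 1]) (use s x in \<open>auto intro: summable_hypergeom\<close>)
  have summ: "summable (\<lambda>n. diffs ?a n * x ^ n)"
    by (rule termdiff_converges[where K = 1]) (use s x in \<open>auto intro: summable_hypergeom\<close>)
  have 1: "(\<lambda>n. diffs ?a n * x ^ n) sums D"
    using summ unfolding D_def by (rule summable_sums)
  have "(\<lambda>n. of_nat n * ?a n * x ^ (n - Suc 0) * x) sums (D * x)"
    unfolding D_def by (intro sums_mult2 diffs_equiv summ)
  moreover have "of_nat n * ?a n * x ^ (n - Suc 0) * x = real n * ?a n * x ^ n" for n
    by (cases n) (simp_all add: algebra_simps)
  ultimately have 2: "(\<lambda>n. real n * ?a n * x ^ n) sums (D * x)" by simp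
  have 3: "(\<lambda>n. (2 * s - 1) * (?a n * x ^ n)) sums ((2 * s - 1) * hypergeom s x)"
    unfolding hypergeom_def by (intro sums_mult summable_sums summable_hypergeom) (use s x in auto)
  have coeff: "diffs ?a n * x ^ n - real n * ?a n * x ^ n - (2 * s - 1) * (?a n * x ^ n)
      = (1 - s)\<^sup>2 / (n + 1) * ?a n * x ^ n" for n
  proof -
    have "(real n + 1) * ((s + n) / (n + 1))\<^sup>2 - n - (2 * s - 1) = (1 - s)\<^sup>2 / (n + 1)"
      by (simp add: power2_eq_square divide_simps) (simp add: algebra_simps)
    moreover have "diffs ?a n = (real n + 1) * ((s + n) / (n + 1))\<^sup>2 * ?a n"
      by (simp only: diffs_def binom_coeff_Suc power_mult_distrib) (simp add: add.commute)
    moreover have "diffs ?a n * x ^ n - real n * ?a n * x ^ n - (2 * s - 1) * (?a n * x ^ n)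
        = ((real n + 1) * ((s + n) / (n + 1))\<^sup>2 - n - (2 * s - 1)) * (?a n * x ^ n)"
      if "diffs ?a n = (real n + 1) * ((s + n) / (n + 1))\<^sup>2 * ?a n"
      unfolding that by (simp only: left_diff_distrib mult.assoc)
    ultimately show ?thesis by (simp only: mult.assoc)
  qed
  have "(\<lambda>n. (1 - s)\<^sup>2 / (n + 1) * ?a n * x ^ n) sums (D - D * x - (2 * s - 1) * hypergeom s x)"
    using sums_diff[OF sums_diff[OF 1 2] 3] by (simp only: coeff)
  moreover have "(\<lambda>n. if n = 0 then (1 - s)\<^sup>2 else 0) sums (1 - s)\<^sup>2"
    using sums_single[of 0 "\<lambda>_. (1 - s)\<^sup>2"] by simp
  ultimately have "(1 - s)\<^sup>2 \<le> D - D * x - (2 * s - 1) * hypergeom s x"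
    using x by (elim sums_le[rotated]) (auto simp: binom_coeff_def)
  then show "(1 - s)\<^sup>2 \<le> (1 - x) * D - (2 * s - 1) * hypergeom s x"
    by (simp add: algebra_simps)
qed

lemma wirtinger_radial:
  assumes f: "\<And>w. norm w < 1 \<Longrightarrow> f w = of_real (\<phi> ((norm w)\<^sup>2))"
    and \<phi>: "(\<phi> has_real_derivative D) (at ((norm z)\<^sup>2))" and z: "norm z < 1"
  shows "partial_z f z = of_real D * cnj z" "partial_zbar f z = of_real D * z"
proof -
  have "((\<lambda>w. w \<bullet> w) has_derivative (\<lambda>h. z \<bullet> h + h \<bullet> z)) (at z)"
    by (rule derivative_intros | rule has_derivative_ident)+
  then have "((\<lambda>w. (norm w)\<^sup>2) has_derivative (\<lambda>h. 2 * (z \<bullet> h))) (at z)"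
    by (simp add: power2_norm_eq_inner inner_commute)
  from has_derivative_compose[OF this \<phi>[unfolded has_field_derivative_def]]
  have "((\<lambda>w. complex_of_real (\<phi> ((norm w)\<^sup>2))) has_derivative (\<lambda>h. of_real (D * (2 * (z \<bullet> h))))) (at z)"
    by (rule has_derivative_of_real)
  moreover have "complex_of_real (D * (2 * (z \<bullet> h))) = of_real D * cnj z * h + of_real D * z * cnj h" for h
    by (simp add: complex_eq_iff inner_complex_def algebra_simps)
  ultimately have "((\<lambda>w. complex_of_real (\<phi> ((norm w)\<^sup>2))) has_derivative
      (\<lambda>h. of_real D * cnj z * h + of_real D * z * cnj h)) (at z)" by simp
  then have "(f has_derivative (\<lambda>h. of_real D * cnj z * h + of_real D * z * cnj h)) (at z)"
    by (rule has_derivative_transform_within_open[of _ _ _ _ "ball 0 1"]) (use f z in auto)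
  then show "partial_z f z = of_real D * cnj z" "partial_zbar f z = of_real D * z"
    by (rule wirtinger_derivatives)+
qed

lemma C_const_pos: "\<alpha> > - 1 \<Longrightarrow> C_const \<alpha> > 0"
  unfolding C_const_def by (intro divide_pos_pos zero_less_power Gamma_real_pos) auto

text \<open>The integral is a radial function of the form \<open>\<phi> (|z|\<^sup>2)\<close>, so all three derivatives have modulus
  \<open>|z| |\<phi>'(|z|\<^sup>2)|\<close>, up to a factor \<open>2\<close> for the radial one.\<close>

lemma K_integral_const_wirtinger_bounds:
  assumes \<alpha>: "- 1 < \<alpha>" and z: "norm z < 1"
  defines "f \<equiv> K_integral \<alpha> (\<lambda>_. 1)"
  defines "b \<equiv> C_const \<alpha> * (\<alpha> / 2)\<^sup>2 * norm z * (1 - (norm z)\<^sup>2) powr \<alpha>"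
  shows "b \<le> norm (partial_z f z)" "b \<le> norm (partial_zbar f z)" "b \<le> norm (partial_r f z)"
proof -
  let ?s = "1 + \<alpha> / 2" and ?x = "(norm z)\<^sup>2"
  have x: "0 \<le> ?x" "?x < 1" using z by (auto simp: abs_square_less_1)
  obtain D where D: "(hypergeom ?s has_real_derivative D) (at ?x)"
    and le: "(1 - ?s)\<^sup>2 \<le> (1 - ?x) * D - (2 * ?s - 1) * hypergeom ?s ?x"
    using hypergeom_derivative_bound[of ?s ?x] \<alpha> x by auto
  define E where "E = C_const \<alpha> * ((1 - ?x) powr \<alpha> * ((1 - ?x) * D - (2 * ?s - 1) * hypergeom ?s ?x))"
  have deriv: "((\<lambda>x. C_const \<alpha> * (1 - x) powr (\<alpha> + 1) * hypergeom ?s x) has_real_derivative E) (at ?x)"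
  proof -
    have "((\<lambda>x. 1 - x) has_real_derivative - 1) (at ?x)"
      by (auto intro!: derivative_eq_intros)
    from DERIV_chain2[OF has_real_derivative_powr this, of "\<alpha> + 1"]
    have "((\<lambda>x. (1 - x) powr (\<alpha> + 1)) has_real_derivative - ((\<alpha> + 1) * (1 - ?x) powr \<alpha>)) (at ?x)"
      using x by simp
    from DERIV_cmult[OF DERIV_mult[OF this D], of "C_const \<alpha>"]
    have "((\<lambda>x. C_const \<alpha> * (1 - x) powr (\<alpha> + 1) * hypergeom ?s x) has_real_derivative
        C_const \<alpha> * (- ((\<alpha> + 1) * (1 - ?x) powr \<alpha>) * hypergeom ?s ?x + D * (1 - ?x) powr (\<alpha> + 1))) (at ?x)"
      by (simp only: mult.assoc)
    moreover have "- ((\<alpha> + 1) * (1 - ?x) powr \<alpha>) * hypergeom ?s ?x + D * (1 - ?x) powr (\<alpha> + 1)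
        = (1 - ?x) powr \<alpha> * ((1 - ?x) * D - (2 * ?s - 1) * hypergeom ?s ?x)"
    proof -
      have "(1 - ?x) powr (\<alpha> + 1) = (1 - ?x) powr \<alpha> * (1 - ?x)"
        using x by (simp add: powr_add)
      then show ?thesis by (simp only:) (simp add: algebra_simps)
    qed
    ultimately show ?thesis unfolding E_def by (simp only:)
  qed
  have f: "f w = of_real (C_const \<alpha> * (1 - (norm w)\<^sup>2) powr (\<alpha> + 1) * hypergeom ?s ((norm w)\<^sup>2))"
    if "norm w < 1" for w
    unfolding f_def using K_integral_const[OF \<alpha> that] .
  have part: "partial_z f z = of_real E * cnj z" "partial_zbar f z = of_real E * z"
    by (rule wirtinger_radial[OF _ deriv z]; rule f; assumption)+
  have "(\<alpha> / 2)\<^sup>2 \<le> (1 - ?x) * D - (2 * ?s - 1) * hypergeom ?s ?x"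
    using le by (simp add: power2_eq_square)
  then have "C_const \<alpha> * ((1 - ?x) powr \<alpha> * (\<alpha> / 2)\<^sup>2) \<le> E"
    unfolding E_def using C_const_pos[OF \<alpha>] by (intro mult_left_mono) auto
  from mult_right_mono[OF this, of "norm z"]
  have bE: "b \<le> E * norm z" by (simp add: b_def mult_ac)
  have b0: "0 \<le> b" using C_const_pos[OF \<alpha>] by (simp add: b_def)
  have bE': "b \<le> \<bar>E\<bar> * norm z"
    using bE by (rule order_trans) (intro mult_right_mono, auto)
  show "b \<le> norm (partial_z f z)" "b \<le> norm (partial_zbar f z)"
    using bE' by (simp_all add: part norm_mult)
  show "b \<le> norm (partial_r f z)"
  proof (cases "z = 0")
    case True
    then show ?thesis by (simp add: b_def)
  next
    case False
    have "norm z * norm (partial_r f z) = norm (z * partial_z f z + cnj z * partial_zbar f z)"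
      by (rule norm_mult_partial_r)
    also have "z * partial_z f z + cnj z * partial_zbar f z = 2 * of_real E * (z * cnj z)"
      unfolding part by (simp add: algebra_simps)
    also have "norm (2 * of_real E * (z * cnj z)) = norm z * (2 * (\<bar>E\<bar> * norm z))"
      by (simp add: norm_mult)
    finally have "norm (partial_r f z) = 2 * (\<bar>E\<bar> * norm z)" using False by simp
    then show ?thesis using bE' b0 by linarith
  qed
qed

section \<open>The Poisson integral of a parabola\<close>

text \<open>The Poisson kernel as the real part of \<open>(1 + w) / (1 - w)\<close>, written as two geometric series.\<close>

lemma K_kernel_0:
  assumes "norm w < 1"
  shows "complex_of_real (K_kernel 0 w) = 1 / (1 - w) + 1 / (1 - cnj w) - 1"
proof -
  have ne: "1 - w \<noteq> 0" using assms by auto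
  then have ne': "1 - cnj w \<noteq> 0" by (metis complex_cnj_cnj complex_cnj_one right_minus_eq)
  have x: "0 < 1 - (norm w)\<^sup>2" using assms by (simp add: abs_square_less_1)
  have "K_kernel 0 w = (1 - (norm w)\<^sup>2) / (norm (1 - w))\<^sup>2"
    using x ne by (simp add: K_kernel_def C_const_def)
  then have "complex_of_real (K_kernel 0 w) = (1 - w * cnj w) / ((1 - w) * (1 - cnj w))"
    by (simp add: complex_norm_square del: of_real_power)
  also have "\<dots> = 1 / (1 - w) + 1 / (1 - cnj w) - 1"
  proof -
    have "(a + b - a * b) / (a * b) = 1 / a + 1 / b - 1" if "a \<noteq> 0" "b \<noteq> 0" for a b :: complex
      using that by (simp add: field_simps)
    from this[OF ne ne'] show ?thesis by (simp add: algebra_simps)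
  qed
  finally show ?thesis .
qed

text \<open>The harmonic extension multiplies the Fourier coefficients of index \<open>n\<close> and \<open>- n\<close> by \<open>z ^ n\<close> and
  \<open>cnj z ^ n\<close>. The coefficient of index \<open>0\<close> occurs in both halves of the series, hence the extra term.\<close>

lemma K_integral_0_sums:
  assumes H: "integrable (lebesgue_on {0..2 * pi}) (\<lambda>t. F (cis t))" and z: "norm z < 1"
  shows "(\<lambda>n. z ^ n * fourier_coeff (\<lambda>t. F (cis t)) n + cnj z ^ n * fourier_coeff (\<lambda>t. F (cis t)) (- n))
     sums (K_integral 0 F z + fourier_coeff (\<lambda>t. F (cis t)) 0)"
proof -
  let ?M = "lebesgue_on {0..2 * pi}" and ?H = "\<lambda>t. F (cis t)"
  let ?S1 = "\<lambda>t. \<Sum>n. z ^ n * cis (- (real n * t))" and ?S2 = "\<lambda>t. \<Sum>n. cnj z ^ n * cis (- (- real n * t))"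
  have sum1: "summable (\<lambda>n. norm (z ^ n))" and sum2: "summable (\<lambda>n. norm (cnj z ^ n))"
    using z by (simp_all add: norm_power summable_geometric)
  note int1 = integrable_series_mult[OF sum1 H, of real]
    and int2 = integrable_series_mult[OF sum2 H, of "\<lambda>n. - real n"]
  have S1: "?S1 t = 1 / (1 - z * cis (- t))" for t
  proof -
    have "z ^ n * cis (- (real n * t)) = (z * cis (- t)) ^ n" for n
      by (simp add: power_mult_distrib cis_minus_power)
    then show ?thesis using z by (simp add: suminf_geometric norm_mult)
  qed
  have S2: "?S2 t = 1 / (1 - cnj (z * cis (- t)))" for t
  proof -
    have "cnj z ^ n * cis (- (- real n * t)) = (cnj (z * cis (- t))) ^ n" for n
      using cis_minus_power[of "- t" n] by (simp add: power_mult_distrib cis_cnj)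
    moreover have "norm (cnj (z * cis (- t))) < 1" using z by (simp add: norm_mult)
    ultimately show ?thesis by (simp only: suminf_geometric)
  qed
  have kernel: "complex_of_real (K_kernel 0 (z * cis (- t))) * ?H t = ?S1 t * ?H t + ?S2 t * ?H t - ?H t" for t
    unfolding S1 S2 using z by (subst K_kernel_0) (simp_all add: norm_mult algebra_simps)
  have "K_integral 0 F z = 1 / (2 * pi) * ((LINT t|?M. ?S1 t * ?H t) + (LINT t|?M. ?S2 t * ?H t) - (LINT t|?M. ?H t))"
    unfolding K_integral_def kernel using int1 int2 H by simp
  also have "\<dots> = 1 / (2 * pi) * (LINT t|?M. ?S1 t * ?H t) + 1 / (2 * pi) * (LINT t|?M. ?S2 t * ?H t) - fourier_coeff ?H 0"
    by (simp add: fourier_coeff_def algebra_simps)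
  finally have "K_integral 0 F z + fourier_coeff ?H 0
      = 1 / (2 * pi) * (LINT t|?M. ?S1 t * ?H t) + 1 / (2 * pi) * (LINT t|?M. ?S2 t * ?H t)"
    by simp
  then show ?thesis
    using sums_add[OF fourier_pairing[OF sum1 H, of real] fourier_pairing[OF sum2 H, of "\<lambda>n. - real n"]]
    by simp
qed

text \<open>The periodic extension of \<open>(t - pi)\<^sup>2\<close> from \<open>[0, 2 pi]\<close>: continuous on the circle, with a corner
  at \<open>1\<close>. \<open>Arg2pi\<close> is used because its branch cut is at that corner.\<close>

definition parabola :: "complex \<Rightarrow> complex" where
  "parabola w = of_real ((Arg2pi w - pi)\<^sup>2)"

lemma parabola_cis:
  assumes "t \<in> {0..2 * pi}"
  shows "parabola (cis t) = of_real ((t - pi)\<^sup>2)"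
proof (cases "t = 2 * pi")
  case True
  have "Arg2pi (cis (2 * pi)) = 0" by (simp add: Arg2pi_eq_0)
  with True show ?thesis by (simp add: parabola_def power2_eq_square)
next
  case False
  then have "Arg2pi (cis t) = t"
    using assms by (intro Arg2pi_unique[of 1]) (auto simp: cis_conv_exp)
  then show ?thesis by (simp add: parabola_def)
qed

lemma integrable_parabola: "integrable (lebesgue_on {0..2 * pi}) (\<lambda>t. parabola (cis t))"
proof (rule integrable_continuous_circle)
  have "continuous_on {0..2 * pi} (\<lambda>t. complex_of_real ((t - pi)\<^sup>2))"
    by (intro continuous_intros)
  then show "continuous_on {0..2 * pi} (\<lambda>t. parabola (cis t))"
    by (rule continuous_on_eq) (simp add: parabola_cis)
qed

lemma fourier_coeff_parabola:
  assumes k: "k \<in> \<int>" "k \<noteq> 0"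
  shows "fourier_coeff (\<lambda>t. parabola (cis t)) k = 2 / k\<^sup>2"
proof -
  define K where "K = complex_of_real k"
  have K: "K \<noteq> 0" using k by (simp add: K_def)
  \<comment> \<open>\<open>?P\<close> is the quadratic polynomial for which \<open>?P' - \<i> K ?P = u\<^sup>2\<close>. Its even part cancels between the
    end points, where \<open>u = - pi\<close> and \<open>u = pi\<close>.\<close>
  let ?P = "\<lambda>u. \<i> / K * u\<^sup>2 + 2 / K\<^sup>2 * u - 2 * \<i> / K ^ 3"
  let ?W = "\<lambda>t. cis (- (k * t)) * ?P (of_real (t - pi))"
  have "(?W has_vector_derivative cis (- (k * t)) * parabola (cis t)) (at t within {0..2*pi})"
    if t: "t \<in> {0..2 * pi}" for t
  proof -
    define u where "u = complex_of_real (t - pi)"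
    have 1: "((\<lambda>t. cis (- (k * t))) has_vector_derivative - K * \<i> * cis (- (k * t))) (at t within {0..2*pi})"
      unfolding has_vector_derivative_def
      by (rule has_derivative_eq_rhs, rule has_derivative_cis, rule derivative_intros,
          rule has_derivative_mult_right, rule has_derivative_ident)
        (simp add: fun_eq_iff scaleR_conv_of_real algebra_simps K_def)
    have id: "((\<lambda>t. complex_of_real (t - pi)) has_vector_derivative 1) (at t within {0..2*pi})"
      by (auto intro!: derivative_eq_intros)
    have "((\<lambda>u. A * u\<^sup>2 + B * u - C) has_field_derivative A * (2 * u) + B) (at u)" for A B C
      by (auto intro!: derivative_eq_intros)
    then have "(?P has_field_derivative \<i> / K * (2 * u) + 2 / K\<^sup>2) (at u)" .
    from field_vector_diff_chain_within[OF id has_field_derivative_at_within, unfolded o_def, OF this[unfolded u_def]]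
    have 2: "((\<lambda>t. ?P (of_real (t - pi))) has_vector_derivative \<i> / K * (2 * u) + 2 / K\<^sup>2) (at t within {0..2*pi})"
      by (simp add: u_def)
    have W: "(?W has_vector_derivative cis (- (k * t)) * (\<i> / K * (2 * u) + 2 / K\<^sup>2)
        + - K * \<i> * cis (- (k * t)) * ?P u) (at t within {0..2*pi})"
      using has_vector_derivative_mult[OF 1 2] unfolding u_def .
    have "cis (- (k * t)) * (\<i> / K * (2 * u) + 2 / K\<^sup>2) + - K * \<i> * cis (- (k * t)) * ?P u
        = cis (- (k * t)) * (\<i> / K * (2 * u) + 2 / K\<^sup>2 - \<i> * K * ?P u)"
      by (simp add: algebra_simps)
    also have "\<i> / K * (2 * u) + 2 / K\<^sup>2 - \<i> * K * ?P u = u\<^sup>2"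
      using K by (simp add: field_simps power2_eq_square power3_eq_cube)
    finally have "(?W has_vector_derivative cis (- (k * t)) * u\<^sup>2) (at t within {0..2*pi})"
      using W by (simp only:)
    then show ?thesis using t by (simp add: parabola_cis u_def)
  qed
  from fourier_coeff_eqI[OF this integrable_parabola]
  have "fourier_coeff (\<lambda>t. parabola (cis t)) k = (?W (2 * pi) - ?W 0) / (2 * pi)" .
  also have "cis (- (k * (2 * pi))) = 1"
  proof -
    have "- (k * (2 * pi)) = 2 * pi * (- k)" by simp
    then show ?thesis using k by (simp only: cis_multiple_2pi Ints_minus)
  qed
  also have "(1 * ?P (of_real (2 * pi - pi)) - cis (- (k * 0)) * ?P (of_real (0 - pi))) / (2 * pi) = 2 / K\<^sup>2"
    by (simp add: field_simps)
  finally show ?thesis by (simp add: K_def)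
qed

text \<open>The Fourier coefficients of the parabola with index \<open>n > 0\<close>. For \<open>n = 0\<close> the value is \<open>0\<close>, as
  division by zero yields zero.\<close>

definition twice_dilog_coeff :: "nat \<Rightarrow> complex" where
  "twice_dilog_coeff n = 2 / (of_nat n)\<^sup>2"

definition twice_dilog :: "complex \<Rightarrow> complex" where
  "twice_dilog z = (\<Sum>n. twice_dilog_coeff n * z ^ n)"

lemma summable_twice_dilog:
  assumes "norm z < 1"
  shows "summable (\<lambda>n. twice_dilog_coeff n * z ^ n)"
proof (rule summable_comparison_test)
  show "summable (\<lambda>n. 2 * norm z ^ n)"
    using assms by (intro summable_mult summable_geometric) auto
  have "norm (twice_dilog_coeff n) \<le> 2" for n
    by (cases n) (auto simp: twice_dilog_coeff_def norm_divide norm_power divide_le_eq simp del: of_nat_Suc intro: one_le_power)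
  then show "\<exists>N. \<forall>n\<ge>N. norm (twice_dilog_coeff n * z ^ n) \<le> 2 * norm z ^ n"
    by (auto simp: norm_mult norm_power intro!: mult_right_mono)
qed

lemma K_integral_0_parabola:
  assumes z: "norm z < 1"
  shows "K_integral 0 parabola z
    = fourier_coeff (\<lambda>t. parabola (cis t)) 0 + twice_dilog z + cnj (twice_dilog z)"
proof -
  let ?c = "fourier_coeff (\<lambda>t. parabola (cis t))"
  have "z ^ n * ?c n + cnj z ^ n * ?c (- n)
      = (twice_dilog_coeff n * z ^ n + cnj (twice_dilog_coeff n * z ^ n)) + (if n = 0 then 2 * ?c 0 else 0)" for n
    by (cases "n = 0") (auto simp: fourier_coeff_parabola twice_dilog_coeff_def mult.commute)
  moreover have "(\<lambda>n. (twice_dilog_coeff n * z ^ n + cnj (twice_dilog_coeff n * z ^ n)) + (if n = 0 then 2 * ?c 0 else 0))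
      sums ((twice_dilog z + cnj (twice_dilog z)) + 2 * ?c 0)"
    unfolding twice_dilog_def
    by (intro sums_add sums_cnj[THEN iffD2] summable_sums summable_twice_dilog z sums_single[of 0 "\<lambda>_. 2 * ?c 0"])
  ultimately have "K_integral 0 parabola z + ?c 0 = (twice_dilog z + cnj (twice_dilog z)) + 2 * ?c 0"
    using K_integral_0_sums[OF integrable_parabola z] by (simp add: sums_unique2)
  then show ?thesis by (simp add: algebra_simps)
qed

text \<open>Differentiation cancels one factor \<open>n\<close> and leaves the logarithmic series.\<close>

lemma twice_dilog_derivative:
  assumes z: "norm z < 1"
  obtains l where "(twice_dilog has_field_derivative l) (at z)" "z * l = - 2 * Ln (1 - z)"
proof
  define l where "l = (\<Sum>n. diffs twice_dilog_coeff n * z ^ n)"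
  show "(twice_dilog has_field_derivative l) (at z)"
    unfolding twice_dilog_def[abs_def] l_def
    by (rule termdiffs_strong'[where K = 1]) (use z in \<open>auto intro: summable_twice_dilog\<close>)
  have summ: "summable (\<lambda>n. diffs twice_dilog_coeff n * z ^ n)"
    by (rule termdiff_converges[where K = 1]) (use z in \<open>auto intro: summable_twice_dilog\<close>)
  have "(\<lambda>n. z * (of_nat n * twice_dilog_coeff n * z ^ (n - Suc 0))) sums (z * l)"
    unfolding l_def by (intro sums_mult diffs_equiv summ)
  moreover have "(\<lambda>n. - 2 * (- ((- (- z)) ^ n) / of_nat n)) sums (- 2 * Ln (1 + (- z)))"
    by (intro sums_mult Ln_series') (use z in simp)
  moreover have "z * (of_nat n * twice_dilog_coeff n * z ^ (n - Suc 0)) = - 2 * (- ((- (- z)) ^ n) / of_nat n)" for n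
    by (cases n) (simp_all add: twice_dilog_coeff_def power2_eq_square field_simps del: of_nat_Suc)
  ultimately show "z * l = - 2 * Ln (1 - z)"
    by (simp add: sums_unique2)
qed

lemma wirtinger_pluriharmonic:
  assumes f: "\<And>w. norm w < 1 \<Longrightarrow> f w = A + L w + cnj (L w)"
    and L: "(L has_field_derivative l) (at z)" and z: "norm z < 1"
  shows "partial_z f z = l" "partial_zbar f z = cnj l"
proof -
  have L': "(L has_derivative (*) l) (at z)"
    using L by (simp add: has_field_derivative_def)
  have "((\<lambda>w. A + L w + cnj (L w)) has_derivative (\<lambda>h. 0 + l * h + cnj (l * h))) (at z)"
    by (intro derivative_intros L' has_derivative_cnj)
  then have "((\<lambda>w. A + L w + cnj (L w)) has_derivative (\<lambda>h. l * h + cnj l * cnj h)) (at z)"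
    by simp
  then have "(f has_derivative (\<lambda>h. l * h + cnj l * cnj h)) (at z)"
    by (rule has_derivative_transform_within_open[of _ _ _ _ "ball 0 1"]) (use f z in auto)
  then show "partial_z f z = l" "partial_zbar f z = cnj l"
    by (rule wirtinger_derivatives)+
qed

text \<open>With \<open>l\<close> the derivative of twice the dilogarithm, \<open>|z l| = 2 |Ln (1 - z)|\<close>. The radial derivative
  sees only the real part of \<open>z l\<close>, which is \<open>- 2 ln |1 - z|\<close>: the part of the logarithm that blows up
  at \<open>1\<close>.\<close>

lemma K_integral_0_parabola_bounds:
  assumes z: "norm z < 1"
  defines "f \<equiv> K_integral 0 parabola"
  shows "- ln (norm (1 - z)) \<le> norm (partial_z f z)" "- ln (norm (1 - z)) \<le> norm (partial_zbar f z)"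
    "- ln (norm (1 - z)) \<le> norm (partial_r f z)"
proof -
  obtain l where l: "(twice_dilog has_field_derivative l) (at z)" "z * l = - 2 * Ln (1 - z)"
    using twice_dilog_derivative[OF z] by blast
  have f: "f w = fourier_coeff (\<lambda>t. parabola (cis t)) 0 + twice_dilog w + cnj (twice_dilog w)" if "norm w < 1" for w
    unfolding f_def using K_integral_0_parabola[OF that] .
  have part: "partial_z f z = l" "partial_zbar f z = cnj l"
    by (rule wirtinger_pluriharmonic[OF _ l(1) z]; rule f; assumption)+
  have ne: "1 - z \<noteq> 0" using z by auto
  have re: "Re (z * l) = - 2 * ln (norm (1 - z))" using ne by (simp add: l)
  have le: "x \<le> y" if "2 * \<bar>x\<bar> \<le> norm z * y" "0 \<le> y" for x y :: real
  proof -
    have "norm z * y \<le> 1 * y" using z that by (intro mult_right_mono) auto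
    then show ?thesis using that by linarith
  qed
  have "\<bar>Re (z * l)\<bar> \<le> norm z * norm l"
    using abs_Re_le_cmod[of "z * l"] by (simp only: norm_mult)
  then have "2 * \<bar>- ln (norm (1 - z))\<bar> \<le> norm z * norm l"
    unfolding re by (simp add: abs_mult)
  then have "- ln (norm (1 - z)) \<le> norm l"
    by (rule le) simp
  then show "- ln (norm (1 - z)) \<le> norm (partial_z f z)" "- ln (norm (1 - z)) \<le> norm (partial_zbar f z)"
    by (simp_all add: part)
  have "norm z * norm (partial_r f z) = norm (z * partial_z f z + cnj z * partial_zbar f z)"
    by (rule norm_mult_partial_r)
  also have "z * partial_z f z + cnj z * partial_zbar f z = z * l + cnj (z * l)"
    unfolding part by simp
  also have "norm (z * l + cnj (z * l)) = 2 * \<bar>Re (z * l)\<bar>"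
    unfolding complex_add_cnj by (simp only: norm_of_real abs_mult abs_numeral)
  also have "\<dots> = 4 * \<bar>- ln (norm (1 - z))\<bar>"
    unfolding re by (simp add: abs_mult)
  finally have "2 * \<bar>- ln (norm (1 - z))\<bar> \<le> norm z * norm (partial_r f z)"
    by simp
  then show "- ln (norm (1 - z)) \<le> norm (partial_r f z)"
    by (rule le) simp
qed

lemma B_norm_top_eq_top_of_log_growth:
  assumes g: "\<And>z. norm z < 1 \<Longrightarrow> - ln (norm (1 - z)) \<le> norm (g z)"
  shows "B_norm \<infinity> g = \<infinity>"
proof (rule B_norm_top_eq_top)
  fix M :: real
  define e where "e = min 1 (exp (- M))"
  have e: "0 < e" "e \<le> 1" "e \<le> exp (- M)" by (auto simp: e_def)
  have "open (unit_disc \<inter> ball 1 e)" by auto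
  moreover have "of_real (1 - e / 2) \<in> unit_disc \<inter> ball (1::complex) e"
  proof -
    have "norm (of_real (1 - e / 2) :: complex) < 1" using e by (simp only: norm_of_real)
    moreover have "norm (1 - of_real (1 - e / 2) :: complex) < e"
    proof -
      have "1 - of_real (1 - e / 2) = complex_of_real (e / 2)" by simp
      then show ?thesis using e by (simp only: norm_of_real)
    qed
    ultimately show ?thesis by (simp only: Int_iff mem_ball dist_norm diff_0 norm_minus_cancel simp_thms)
  qed
  moreover have "M \<le> norm (g z)" if "z \<in> unit_disc \<inter> ball 1 e" for z
  proof -
    have z: "norm z < 1" "norm (1 - z) < e" using that by (auto simp: dist_norm)
    then have "0 < norm (1 - z)" by auto
    then have "ln (norm (1 - z)) \<le> ln (exp (- M))"
      using z e by (subst ln_le_cancel_iff) auto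
    then show ?thesis using g[OF z(1)] by simp
  qed
  ultimately show "\<exists>U. open U \<and> U \<noteq> {} \<and> U \<subseteq> unit_disc \<and> (\<forall>z\<in>U. M \<le> norm (g z))"
    by (intro exI[of _ "unit_disc \<inter> ball 1 e"] conjI ballI) auto
qed

section \<open>Admissibility of the boundary functions\<close>

lemma absolutely_continuous_circle_lipschitz:
  assumes L: "L \<ge> 0"
    and lip: "\<And>x y. 0 \<le> x \<Longrightarrow> x \<le> y \<Longrightarrow> y \<le> 2 * pi \<Longrightarrow> norm (F (cis y) - F (cis x)) \<le> L * (y - x)"
  shows "absolutely_continuous_circle F"
  unfolding absolutely_continuous_circle_def absolutely_continuous_on_interval_def
proof (intro allI impI)
  fix \<epsilon> :: real assume \<epsilon>: "\<epsilon> > 0"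
  show "\<exists>\<delta>>0. \<forall>(n::nat) (x::nat \<Rightarrow> real) y. (\<forall>i<n. 0 \<le> x i \<and> x i \<le> y i \<and> y i \<le> 2 * pi) \<and>
        disjoint_family_on (\<lambda>i. {x i<..<y i}) {..<n} \<and> (\<Sum>i<n. y i - x i) < \<delta> \<longrightarrow>
        (\<Sum>i<n. norm (F (cis (y i)) - F (cis (x i)))) < \<epsilon>"
  proof (intro exI[of _ "\<epsilon> / (L + 1)"] conjI allI impI)
    show "\<epsilon> / (L + 1) > 0" using \<epsilon> L by simp
    fix n :: nat and x y :: "nat \<Rightarrow> real"
    assume *: "(\<forall>i<n. 0 \<le> x i \<and> x i \<le> y i \<and> y i \<le> 2 * pi) \<and>
        disjoint_family_on (\<lambda>i. {x i<..<y i}) {..<n} \<and> (\<Sum>i<n. y i - x i) < \<epsilon> / (L + 1)"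
    have "(\<Sum>i<n. norm (F (cis (y i)) - F (cis (x i)))) \<le> (\<Sum>i<n. L * (y i - x i))"
      using * by (intro sum_mono lip) auto
    also have "\<dots> = L * (\<Sum>i<n. y i - x i)" by (simp add: sum_distrib_left)
    also have "\<dots> \<le> (L + 1) * (\<Sum>i<n. y i - x i)"
      using * by (intro mult_right_mono sum_nonneg) auto
    also have "\<dots> < \<epsilon>" using * L by (simp add: pos_less_divide_eq mult.commute)
    finally show "(\<Sum>i<n. norm (F (cis (y i)) - F (cis (x i)))) < \<epsilon>" .
  qed
qed

lemma in_Lp_zero: "in_Lp M p (\<lambda>_. 0)"
proof -
  have "esssup M (\<lambda>_. 0 :: ennreal) \<le> 0" by (rule esssup_I) auto
  then show ?thesis by (simp add: in_Lp_def Lp_norm_def ennreal_powr_def)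
qed

lemma absolutely_continuous_parabola: "absolutely_continuous_circle parabola"
proof (rule absolutely_continuous_circle_lipschitz)
  show "0 \<le> 2 * pi" by simp
  fix x y :: real assume xy: "0 \<le> x" "x \<le> y" "y \<le> 2 * pi"
  have "norm (parabola (cis y) - parabola (cis x)) = \<bar>(y - pi)\<^sup>2 - (x - pi)\<^sup>2\<bar>"
    using xy by (simp add: parabola_cis flip: of_real_diff of_real_power)
  also have "(y - pi)\<^sup>2 - (x - pi)\<^sup>2 = (y + x - 2 * pi) * (y - x)"
    by (simp add: power2_eq_square algebra_simps)
  also have "\<bar>\<dots>\<bar> \<le> 2 * pi * (y - x)"
    unfolding abs_mult using xy by (intro mult_mono) auto
  finally show "norm (parabola (cis y) - parabola (cis x)) \<le> 2 * pi * (y - x)" .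
qed

lemma circle_deriv_parabola:
  assumes "0 < \<theta>" "\<theta> < 2 * pi"
  shows "circle_deriv parabola \<theta> = of_real (2 * (\<theta> - pi))"
  unfolding circle_deriv_def
proof (rule vector_derivative_at, rule has_vector_derivative_transform_within_open)
  show "((\<lambda>t. complex_of_real ((t - pi)\<^sup>2)) has_vector_derivative of_real (2 * (\<theta> - pi))) (at \<theta>)"
    by (rule has_vector_derivative_of_real) (auto intro!: derivative_eq_intros)
  show "open {0<..<2 * pi}" "\<theta> \<in> {0<..<2 * pi}" using assms by auto
qed (auto simp: parabola_cis)

text \<open>The angular derivative is \<open>2 (\<theta> - pi)\<close> inside the interval. The two end points carry unspecified
  values, which are included in the bound \<open>m\<close>.\<close>

lemma in_Lp_circle_deriv_parabola:
  "in_Lp (lebesgue_on {0..2 * pi}) \<infinity> (circle_deriv parabola)"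
proof -
  let ?M = "lebesgue_on {0..2 * pi}" and ?D = "circle_deriv parabola"
  have eq: "?D \<theta> = (if \<theta> = 0 then ?D 0 else if \<theta> = 2 * pi then ?D (2 * pi) else of_real (2 * (\<theta> - pi)))"
    if "\<theta> \<in> {0..2 * pi}" for \<theta>
    using that circle_deriv_parabola[of \<theta>] by auto
  have "(\<lambda>\<theta>. if \<theta> = 0 then ?D 0 else if \<theta> = 2 * pi then ?D (2 * pi) else of_real (2 * (\<theta> - pi)))
      \<in> borel_measurable borel"
    by measurable
  then have "(\<lambda>\<theta>. if \<theta> = 0 then ?D 0 else if \<theta> = 2 * pi then ?D (2 * pi) else of_real (2 * (\<theta> - pi)))
      \<in> borel_measurable ?M"
    by (intro measurable_restrict_space1 measurable_completion) simp
  then have meas: "?D \<in> borel_measurable ?M"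
    by (rule measurable_cong[THEN iffD1, rotated]) (subst eq, auto)
  define m where "m = max (2 * pi) (max (norm (?D 0)) (norm (?D (2 * pi))))"
  have "norm (?D \<theta>) \<le> m" if "\<theta> \<in> {0..2 * pi}" for \<theta>
  proof -
    have "norm (complex_of_real (2 * (\<theta> - pi))) \<le> 2 * pi"
      using that by (simp only: norm_of_real) auto
    then show ?thesis by (subst eq[OF that]) (auto simp: m_def)
  qed
  then have "esssup ?M (\<lambda>\<theta>. ennreal (norm (?D \<theta>))) \<le> ennreal m"
    using meas by (intro esssup_I) (auto intro!: AE_I2 ennreal_leI)
  then show ?thesis
    using meas by (auto simp: in_Lp_def Lp_norm_def intro: le_less_trans)
qed

theorem theorem1p4:
  fixes \<alpha> :: real and p :: ennreal
  assumes "(\<alpha>, p) \<in> Pi3"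
  shows "\<exists>F :: complex \<Rightarrow> complex.
           absolutely_continuous_circle F \<and>
           in_Lp (lebesgue_on {0..2 * pi}) p (circle_deriv F) \<and>
           (let f = K_integral \<alpha> F in
              B_norm p (partial_r f) = \<infinity> \<and>
              B_norm p (partial_z f) = \<infinity> \<and>
              B_norm p (partial_zbar f) = \<infinity>)"
proof (cases "\<alpha> = 0")
  case True
  then have p: "p = \<infinity>" using assms by (auto simp: Pi3_def)
  note bounds = K_integral_0_parabola_bounds
  show ?thesis
    unfolding True p Let_def
    by (intro exI[of _ parabola] conjI absolutely_continuous_parabola in_Lp_circle_deriv_parabola
        B_norm_top_eq_top_of_log_growth bounds)
next
  case False
  then have \<alpha>: "- 1 < \<alpha>" "\<alpha> < 0" and p: "ennreal (- 1 / \<alpha>) \<le> p"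
    using assms by (auto simp: Pi3_def)
  have c: "C_const \<alpha> * (\<alpha> / 2)\<^sup>2 > 0" using C_const_pos[OF \<alpha>(1)] \<alpha> by simp
  have "circle_deriv (\<lambda>_. 1) = (\<lambda>_. 0)" by (simp add: circle_deriv_def fun_eq_iff)
  then have "in_Lp (lebesgue_on {0..2 * pi}) p (circle_deriv (\<lambda>_. 1))" by (simp add: in_Lp_zero)
  moreover have "absolutely_continuous_circle (\<lambda>_. 1)"
    by (rule absolutely_continuous_circle_lipschitz[of 0]) auto
  ultimately show ?thesis
    unfolding Let_def
    by (intro exI[of _ "\<lambda>_. 1"] conjI B_norm_eq_top_of_boundary_growth[OF \<alpha>(2) p c]
        K_integral_const_wirtinger_bounds \<alpha>)
qed

end
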